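(* Let $k\ge 3$. If there exists a $(k-1)$-chromatic $3$-star system (of some order), then there exists a $k$-chromatic $3$-star system (of some order).
   Context: An $e$-star is the complete bipartite graph $K_{1,e}$. An $e$-star system of order $n$ is a pair $(V,\mathcal B)$ where $|V|=n$ and $\mathcal B$ is a set of $e$-stars (subgraphs of the complete graph $K_n$ on $V$) whose edge sets partition the edge set of $K_n$. An $e$-star system is $k$-colourable if $V$ can be partitioned into $k$ sets (colour classes) such that no star in $\mathcal B$ has all its vertices in the same class; it is $k$-chromatic if it is $k$-colourable but not $(k-1)$-colourable. *)

theory Defs
  imports "HOL-Library.Disjoint_Sets"
begin

text \<open>A simple graph is a pair of its vertex set and its edge set, an edge being the
  two-element set of its ends.\<close>

type_synonym 'a sgraph = "'a set \<times> 'a set set"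

abbreviation verts :: "'a sgraph \<Rightarrow> 'a set" where
  "verts \<equiv> fst"

abbreviation edges :: "'a sgraph \<Rightarrow> 'a set set" where
  "edges \<equiv> snd"

definition complete_graph :: "'a set \<Rightarrow> 'a sgraph" where
  "complete_graph V = (V, {{x, y} | x y. x \<in> V \<and> y \<in> V \<and> x \<noteq> y})"

definition complete_bipartite :: "'a set \<Rightarrow> 'a set \<Rightarrow> 'a sgraph" where
  "complete_bipartite X Y = (X \<union> Y, {{x, y} | x y. x \<in> X \<and> y \<in> Y})"

definition subgraph :: "'a sgraph \<Rightarrow> 'a sgraph \<Rightarrow> bool" where
  "subgraph H G \<longleftrightarrow> verts H \<subseteq> verts G \<and> edges H \<subseteq> edges G"

definition is_star :: "nat \<Rightarrow> 'a sgraph \<Rightarrow> bool" where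
  "is_star e S \<longleftrightarrow>
     (\<exists>c L. finite L \<and> card L = e \<and> c \<notin> L \<and> S = complete_bipartite {c} L)"

definition star_system :: "nat \<Rightarrow> nat \<Rightarrow> 'a set \<Rightarrow> 'a sgraph set \<Rightarrow> bool" where
  "star_system e n V B \<longleftrightarrow>
     finite V \<and> card V = n \<and>
     (\<forall>S\<in>B. is_star e S \<and> subgraph S (complete_graph V)) \<and>
     disjoint_family_on edges B \<and>
     (\<Union>S\<in>B. edges S) = edges (complete_graph V)"

text \<open>Colour classes are nonempty here. Allowing empty classes would give the same
  \<open>k\<close>-chromatic systems for \<open>k \<ge> 1\<close>, since splitting a class preserves properness.\<close>

definition colourable :: "nat \<Rightarrow> 'a set \<Rightarrow> 'a sgraph set \<Rightarrow> bool" where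
  "colourable k V B \<longleftrightarrow>
     (\<exists>P. partition_on V P \<and> finite P \<and> card P = k \<and>
          (\<forall>S\<in>B. \<not> (\<exists>C\<in>P. verts S \<subseteq> C)))"

text \<open>Only meaningful for \<open>k \<ge> 1\<close>, because of the truncated subtraction.\<close>

definition chromatic :: "nat \<Rightarrow> 'a set \<Rightarrow> 'a sgraph set \<Rightarrow> bool" where
  "chromatic k V B \<longleftrightarrow> colourable k V B \<and> \<not> colourable (k - 1) V B"

end

theory Submission
  imports Defs "HOL-Library.FuncSet"
begin

text \<open>
  A 3-star system is a tournament whose out-neighbourhoods are partitioned into triples. Given a
  \<open>(k - 1)\<close>-chromatic system \<open>V\<close>, take many disjoint copies of \<open>V\<close> and, for every set \<open>t\<close> of three
  copies, a vertex \<open>y\<close> that is the centre of one star for each \<open>v \<in> V\<close>, whose leaves are the three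
  copies of \<open>v\<close> in \<open>t\<close>. In a proper colouring with \<open>k - 1\<close> colours every copy of \<open>V\<close> shows all colours,
  and by the pigeonhole principle three copies are coloured identically; the colour of the
  corresponding \<open>y\<close> occurs at some \<open>v\<close> in these copies, which yields a monochromatic star.

  For a proper colouring with \<open>k\<close> colours, the copies keep the colouring of \<open>V\<close> and the vertices \<open>y\<close>
  get a new colour. To absorb the remaining edges, the vertices \<open>y\<close> are the even members of blocks of
  six, whose odd members are further vertices of some old colour. Then at least a
  third of the still ungrouped out-neighbours of each vertex have a colour different from its own, so
  these can be grouped into triples that each contain such a neighbour.
\<close>

section \<open>Star systems as tournaments with grouped out-neighbourhoods\<close>

text \<open>\<open>F v\<close> is the set of leaf triples of the stars centred at \<open>v\<close>; orienting every edge from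
  the centre to the leaf makes \<open>\<Union>(F v)\<close> the out-neighbourhood of \<open>v\<close> in a tournament.\<close>

definition leaf_system :: "'a set \<Rightarrow> ('a \<Rightarrow> 'a set set) \<Rightarrow> bool" where
  "leaf_system V F \<longleftrightarrow> finite V \<and>
     (\<forall>v\<in>V. disjoint (F v)) \<and>
     (\<forall>v\<in>V. \<forall>L\<in>F v. L \<subseteq> V \<and> card L = 3) \<and>
     (\<forall>v\<in>V. v \<notin> \<Union>(F v)) \<and>
     (\<forall>v\<in>V. \<forall>w\<in>V. v \<noteq> w \<longrightarrow> (w \<in> \<Union>(F v)) \<noteq> (v \<in> \<Union>(F w)))"

definition stars :: "'a set \<Rightarrow> ('a \<Rightarrow> 'a set set) \<Rightarrow> 'a sgraph set" where
  "stars V F = {complete_bipartite {v} L | v L. v \<in> V \<and> L \<in> F v}"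

definition proper :: "('a \<Rightarrow> nat) \<Rightarrow> 'a set \<Rightarrow> ('a \<Rightarrow> 'a set set) \<Rightarrow> bool" where
  "proper f V F \<longleftrightarrow> (\<forall>v\<in>V. \<forall>L\<in>F v. \<exists>w\<in>L. f w \<noteq> f v)"

section \<open>Translation between leaf systems and star systems, and between colourings and
  partitions\<close>

lemma complete_bipartite_singleton:
  "complete_bipartite {c} L = (insert c L, (\<lambda>l. {c, l}) ` L)"
  by (auto simp: complete_bipartite_def)

text \<open>A vertex other than the centre lies on at most one edge of a star, so with three leaves
  the centre can be recovered from the graph.\<close>

lemma complete_bipartite_center_unique:
  assumes "card L = 3" "c \<notin> L" "c' \<notin> L'"
    and eq: "complete_bipartite {c} L = complete_bipartite {c'} L'"
  shows "c = c'" "L = L'"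
proof -
  have V: "insert c L = insert c' L'" and E: "(\<lambda>l. {c, l}) ` L = (\<lambda>l. {c', l}) ` L'"
    using eq by (auto simp: complete_bipartite_singleton)
  show c: "c = c'"
  proof (rule ccontr)
    assume ne: "c \<noteq> c'"
    have "L \<subseteq> {c'}"
    proof
      fix l assume "l \<in> L"
      then have "{c, l} \<in> (\<lambda>l. {c', l}) ` L'" using E by blast
      then have "c' \<in> {c, l}" by blast
      with ne show "l \<in> {c'}" by simp
    qed
    then have "card L \<le> card {c'}" by (intro card_mono) auto
    with assms(1) show False by simp
  qed
  show "L = L'" using V c assms(2,3) by (auto simp: insert_ident)
qed

text \<open>If two stars share an edge, either their centres agree, and disjointness of the triples
  makes them equal, or they orient the edge in opposite directions, which the tournament condition
  excludes.\<close>

lemma star_system_stars: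
  assumes "leaf_system V F"
  shows "star_system 3 (card V) V (stars V F)"
  unfolding star_system_def
proof (intro conjI ballI refl)
  have fin: "finite V" and dis: "\<And>v. v \<in> V \<Longrightarrow> disjoint (F v)"
    and sub: "\<And>v L. v \<in> V \<Longrightarrow> L \<in> F v \<Longrightarrow> L \<subseteq> V"
    and crd: "\<And>v L. v \<in> V \<Longrightarrow> L \<in> F v \<Longrightarrow> card L = 3"
    and irr: "\<And>v L. v \<in> V \<Longrightarrow> L \<in> F v \<Longrightarrow> v \<notin> L"
    and tour: "\<And>v w. v \<in> V \<Longrightarrow> w \<in> V \<Longrightarrow> v \<noteq> w \<Longrightarrow> (w \<in> \<Union>(F v)) \<noteq> (v \<in> \<Union>(F w))"
    using assms unfolding leaf_system_def by blast+
  show "finite V" by fact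
  show "is_star 3 S" if "S \<in> stars V F" for S
  proof -
    obtain v L where S: "v \<in> V" "L \<in> F v" "S = complete_bipartite {v} L"
      using \<open>S \<in> stars V F\<close> by (auto simp: stars_def)
    then have "finite L" using sub fin finite_subset by blast
    with S crd irr show ?thesis unfolding is_star_def by blast
  qed
  show "subgraph S (complete_graph V)" if "S \<in> stars V F" for S
  proof -
    obtain v L where S: "v \<in> V" "L \<in> F v" "S = complete_bipartite {v} L"
      using \<open>S \<in> stars V F\<close> by (auto simp: stars_def)
    have "(\<lambda>l. {v, l}) ` L \<subseteq> edges (complete_graph V)"
      using S(1) sub[OF S(1,2)] irr[OF S(1,2)] by (auto simp: complete_graph_def)
    then show ?thesis
      using S sub[OF S(1,2)]
      by (auto simp: subgraph_def complete_graph_def complete_bipartite_singleton)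
  qed
  show "disjoint_family_on edges (stars V F)"
    unfolding disjoint_family_on_def
  proof (intro ballI impI)
    fix S S' assume "S \<in> stars V F" "S' \<in> stars V F" "S \<noteq> S'"
    then obtain v L v' L' where S: "v \<in> V" "L \<in> F v" "S = complete_bipartite {v} L"
      "v' \<in> V" "L' \<in> F v'" "S' = complete_bipartite {v'} L'"
      by (auto simp: stars_def)
    show "edges S \<inter> edges S' = {}"
    proof (rule ccontr)
      assume "edges S \<inter> edges S' \<noteq> {}"
      then obtain l l' where l: "l \<in> L" "l' \<in> L'" "{v, l} = {v', l'}"
        using S by (auto simp: complete_bipartite_singleton)
      show False
      proof (cases "v = v'")
        case True
        then have "l = l'" using l(3) by (auto simp: doubleton_eq_iff)
        then have "L = L'" using dis[OF S(1)] S(2,5) l(1,2) True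
          by (auto simp: disjoint_def)
        with True S \<open>S \<noteq> S'\<close> show False by simp
      next
        case False
        then have "v = l'" "l = v'" using l(3) by (auto simp: doubleton_eq_iff)
        with tour[OF S(1,4) False] S(2,5) l(1,2) show False by blast
      qed
    qed
  qed
  show "(\<Union>S\<in>stars V F. edges S) = edges (complete_graph V)" (is "?L = ?R")
  proof
    show "?L \<subseteq> ?R"
      using \<open>\<And>S. S \<in> stars V F \<Longrightarrow> subgraph S (complete_graph V)\<close>
      by (auto simp: subgraph_def)
    show "?R \<subseteq> ?L"
    proof
      fix e assume "e \<in> ?R"
      then obtain x y where e: "e = {x, y}" "x \<in> V" "y \<in> V" "x \<noteq> y"
        by (auto simp: complete_graph_def)
      have "\<exists>v w. v \<in> V \<and> w \<in> \<Union>(F v) \<and> e = {v, w}"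
        using tour[OF e(2-4)] e by (metis insert_commute)
      then obtain v w L where vw: "v \<in> V" "w \<in> L" "L \<in> F v" "e = {v, w}" by blast
      then have "complete_bipartite {v} L \<in> stars V F" "e \<in> edges (complete_bipartite {v} L)"
        by (auto simp: stars_def complete_bipartite_singleton)
      then show "e \<in> ?L" by blast
    qed
  qed
qed

text \<open>Stars sharing an edge coincide. Uniqueness of centre and leaves turns this into disjoint
  triples at each vertex and a single orientation of each edge.\<close>

lemma star_system_imp_leaf_system:
  assumes "star_system 3 n V B"
  obtains F where "leaf_system V F" "B = stars V F"
proof
  define F where "F v = {L. finite L \<and> card L = 3 \<and> v \<notin> L \<and> complete_bipartite {v} L \<in> B}" for v
  have fin: "finite V" and star: "\<And>S. S \<in> B \<Longrightarrow> is_star 3 S"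
    and sub: "\<And>S. S \<in> B \<Longrightarrow> subgraph S (complete_graph V)"
    and disj: "\<And>S S' e. S \<in> B \<Longrightarrow> S' \<in> B \<Longrightarrow> e \<in> edges S \<Longrightarrow> e \<in> edges S' \<Longrightarrow> S = S'"
    and cover: "(\<Union>S\<in>B. edges S) = edges (complete_graph V)"
    using assms unfolding star_system_def disjoint_family_on_def by blast+
  show B: "B = stars V F"
  proof
    show "stars V F \<subseteq> B" by (auto simp: stars_def F_def)
    show "B \<subseteq> stars V F"
    proof
      fix S assume S: "S \<in> B"
      then obtain c L where cL: "finite L" "card L = 3" "c \<notin> L" "S = complete_bipartite {c} L"
        using star[OF S] unfolding is_star_def by blast
      then have "c \<in> V" using sub[OF S]
        by (auto simp: subgraph_def complete_graph_def complete_bipartite_singleton)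
      with cL S show "S \<in> stars V F" by (auto simp: stars_def F_def)
    qed
  qed
  have edge: "{v, w} \<in> edges (complete_bipartite {v} L)" if "w \<in> L" for v w :: 'a and L
    using that by (auto simp: complete_bipartite_singleton)
  have F: "card L = 3" "v \<notin> L" "complete_bipartite {v} L \<in> B" if "L \<in> F v" for v L
    using that by (simp_all add: F_def)
  show "leaf_system V F"
    unfolding leaf_system_def
  proof (intro conjI ballI impI)
    show "finite V" by fact
    show "disjoint (F v)" for v
      unfolding disjoint_def
    proof (intro ballI impI)
      fix L L' assume L: "L \<in> F v" "L' \<in> F v" "L \<noteq> L'"
      show "L \<inter> L' = {}"
      proof (rule ccontr)
        assume "L \<inter> L' \<noteq> {}"
        then obtain w where "w \<in> L" "w \<in> L'" by blast
        then have "complete_bipartite {v} L = complete_bipartite {v} L'"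
          by (intro disj[OF F(3)[OF L(1)] F(3)[OF L(2)] edge edge])
        then have "L = L'"
          by (rule complete_bipartite_center_unique(2)[OF F(1,2)[OF L(1)] F(2)[OF L(2)]])
        with L(3) show False by simp
      qed
    qed
    show "L \<subseteq> V" if "L \<in> F v" for v L
      using that sub[of "complete_bipartite {v} L"]
      by (auto simp: F_def subgraph_def complete_graph_def complete_bipartite_singleton)
    show "card L = 3" if "L \<in> F v" for v L using that by (simp add: F_def)
    show "v \<notin> \<Union>(F v)" for v by (auto simp: F_def)
    fix v w assume vw: "v \<in> V" "w \<in> V" "v \<noteq> w"
    have "\<not> (w \<in> \<Union>(F v) \<and> v \<in> \<Union>(F w))"
    proof
      assume "w \<in> \<Union>(F v) \<and> v \<in> \<Union>(F w)"
      then obtain L L' where L: "w \<in> L" "L \<in> F v" "v \<in> L'" "L' \<in> F w" by blast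
      then have "complete_bipartite {v} L = complete_bipartite {w} L'"
        using disj[OF F(3)[OF L(2)] F(3)[OF L(4)] edge[OF L(1)]] edge[OF L(3), of w]
        by (simp add: insert_commute)
      then have "v = w"
        by (rule complete_bipartite_center_unique(1)[OF F(1,2)[OF L(2)] F(2)[OF L(4)]])
      with vw(3) show False by simp
    qed
    moreover have "w \<in> \<Union>(F v) \<or> v \<in> \<Union>(F w)"
    proof -
      have "{v, w} \<in> edges (complete_graph V)" using vw by (auto simp: complete_graph_def)
      then obtain S where "S \<in> stars V F" "{v, w} \<in> edges S" using cover B by blast
      then obtain c L where "L \<in> F c" "{v, w} \<in> (\<lambda>l. {c, l}) ` L"
        by (auto simp: stars_def complete_bipartite_singleton)
      then show ?thesis by (auto simp: doubleton_eq_iff)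
    qed
    ultimately show "(w \<in> \<Union>(F v)) \<noteq> (v \<in> \<Union>(F w))" by blast
  qed
qed

text \<open>Classes correspond to fibres of a colouring; as classes are nonempty, \<open>k\<close>
  classes mean an image of exactly \<open>k\<close> colours.\<close>

lemma colourable_stars_iff:
  assumes "leaf_system V F"
  shows "colourable k V (stars V F) \<longleftrightarrow> (\<exists>f. proper f V F \<and> card (f ` V) = k)"
proof
  assume "colourable k V (stars V F)"
  then obtain P where P: "partition_on V P" "finite P" "card P = k"
    and nm: "\<And>S C. S \<in> stars V F \<Longrightarrow> C \<in> P \<Longrightarrow> \<not> verts S \<subseteq> C"
    unfolding colourable_def by blast
  obtain h :: "'a set \<Rightarrow> nat" where h: "inj_on h P"
    using finite_imp_inj_to_nat_seg[OF P(2)] by blast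
  define cls where "cls v = (THE C. C \<in> P \<and> v \<in> C)" for v
  have cls_eq: "cls v = C" if "C \<in> P" "v \<in> C" for v C
    unfolding cls_def using that partition_onD2[OF P(1)]
    by (intro the_equality) (auto simp: disjoint_def)
  have cls: "cls v \<in> P" "v \<in> cls v" if "v \<in> V" for v
    using that cls_eq partition_onD1[OF P(1)] by auto
  have "cls ` V = P"
  proof (intro subset_antisym subsetI)
    fix C assume C: "C \<in> P"
    then obtain v where "v \<in> C" using partition_onD3[OF P(1)] by (metis ex_in_conv)
    then show "C \<in> cls ` V"
      using cls_eq[OF C] C partition_onD1[OF P(1)] by blast
  qed (use cls(1) in blast)
  then have "card ((h \<circ> cls) ` V) = k"
    using h P(3) by (metis card_image image_comp)
  moreover have "proper (h \<circ> cls) V F"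
    unfolding proper_def
  proof (intro ballI, rule ccontr)
    fix v L assume vL: "v \<in> V" "L \<in> F v" and "\<not> (\<exists>w\<in>L. (h \<circ> cls) w \<noteq> (h \<circ> cls) v)"
    moreover have LV: "L \<subseteq> V" using assms vL by (auto simp: leaf_system_def)
    ultimately have "cls w = cls v" if "w \<in> L" for w
      using that h cls(1) by (auto dest: inj_onD)
    then have "insert v L \<subseteq> cls v" using cls(2) vL(1) LV by blast
    then show False using nm[of "complete_bipartite {v} L" "cls v"] cls(1) vL
      by (auto simp: stars_def complete_bipartite_singleton)
  qed
  ultimately show "\<exists>f. proper f V F \<and> card (f ` V) = k" by blast
next
  assume "\<exists>f. proper f V F \<and> card (f ` V) = k"
  then obtain f where f: "proper f V F" "card (f ` V) = k" by blast
  define P where "P = (\<lambda>c. {v \<in> V. f v = c}) ` f ` V"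
  have "partition_on V P"
    by (rule partition_onI) (auto simp: P_def disjnt_def)
  moreover have "card P = k"
    unfolding P_def f(2)[symmetric] by (rule card_image) (auto simp: inj_on_def)
  moreover have "\<not> verts S \<subseteq> C" if S: "S \<in> stars V F" and C: "C \<in> P" for S C
  proof -
    obtain v L where "v \<in> V" "L \<in> F v" "verts S = insert v L"
      using S by (auto simp: stars_def complete_bipartite_singleton)
    moreover from this f(1) obtain w where "w \<in> L" "f w \<noteq> f v" unfolding proper_def by blast
    ultimately show ?thesis using C by (auto simp: P_def)
  qed
  moreover have "finite P" using assms by (simp add: P_def leaf_system_def)
  ultimately show "colourable k V (stars V F)" unfolding colourable_def by blast
qed

text \<open>Giving a fresh colour to one of two equally coloured vertices never makes different
  colours equal, so properness survives. Hence ruling out exactly \<open>k\<close> colours, where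
  \<open>k \<le> card V\<close>, also rules out fewer.\<close>

lemma proper_refine:
  assumes sys: "leaf_system V F" and "proper f V F" "card (f ` V) \<le> k" "k \<le> card V"
  shows "\<exists>g. proper g V F \<and> card (g ` V) = k"
  using assms(3,4)
proof (induction k rule: dec_induct)
  case base
  then show ?case using assms(2) by blast
next
  case (step k)
  then obtain g where g: "proper g V F" "card (g ` V) = k" by auto
  have fin: "finite V" using sys by (simp add: leaf_system_def)
  have "\<not> inj_on g V" using g(2) step.prems card_image[of g V] by auto
  then obtain v v' where v: "v \<in> V" "v' \<in> V" "v \<noteq> v'" "g v = g v'"
    by (auto simp: inj_on_def)
  obtain c where c: "c \<notin> g ` V" using fin by (meson ex_new_if_finite finite_imageI infinite_UNIV_nat)
  let ?h = "g(v := c)"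
  \<comment> \<open>\<open>v'\<close> keeps the old colour of \<open>v\<close> in the image.\<close>
  have "?h ` V = insert c (g ` V)" using v by (auto simp: image_iff)
  then have "card (?h ` V) = Suc k" using c fin g(2) by simp
  moreover have "proper ?h V F"
    unfolding proper_def
  proof (intro ballI)
    fix u L assume u: "u \<in> V" "L \<in> F u"
    then obtain w where w: "w \<in> L" "g w \<noteq> g u" using g(1) unfolding proper_def by blast
    have "w \<in> V" using sys u w(1) unfolding leaf_system_def by blast
    then have "?h w \<noteq> ?h u" using w(2) c u(1) by auto
    with w(1) show "\<exists>w\<in>L. ?h w \<noteq> ?h u" by blast
  qed
  ultimately show ?case by blast
qed

text \<open>Serves to move the constructed system from \<open>'a point\<close> to the
  naturals.\<close>

lemma leaf_system_image:
  assumes sys: "leaf_system V F" and h: "inj_on h V"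
  defines "G \<equiv> \<lambda>v. (`) h ` F (inv_into V h v)"
  shows "leaf_system (h ` V) G"
    and "proper g (h ` V) G \<longleftrightarrow> proper (g \<circ> h) V F"
proof -
  have fin: "finite V" and dis: "\<And>v. v \<in> V \<Longrightarrow> disjoint (F v)"
    and sub: "\<And>v L. v \<in> V \<Longrightarrow> L \<in> F v \<Longrightarrow> L \<subseteq> V"
    and crd: "\<And>v L. v \<in> V \<Longrightarrow> L \<in> F v \<Longrightarrow> card L = 3"
    and irr: "\<And>v. v \<in> V \<Longrightarrow> v \<notin> \<Union>(F v)"
    and tour: "\<And>v w. v \<in> V \<Longrightarrow> w \<in> V \<Longrightarrow> v \<noteq> w \<Longrightarrow> (w \<in> \<Union>(F v)) \<noteq> (v \<in> \<Union>(F w))"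
    using sys unfolding leaf_system_def by blast+
  have G: "G (h v) = (`) h ` F v" if "v \<in> V" for v
    using that h by (simp add: G_def)
  have mem: "h w \<in> \<Union>(G (h v)) \<longleftrightarrow> w \<in> \<Union>(F v)" if "v \<in> V" "w \<in> V" for v w
    using inj_on_image_mem_iff[OF h that(2) sub[OF that(1)]] unfolding G[OF that(1)] by auto
  show "leaf_system (h ` V) G"
    unfolding leaf_system_def
  proof (intro conjI ballI impI; (elim imageE)?; (simp only:)?)
    show "finite (h ` V)" using fin by simp
  next
    fix v assume v: "v \<in> V"
    show "disjoint (G (h v))"
      unfolding G[OF v] by (intro disjoint_image inj_on_subset[OF h] dis v) (use sub v in blast)
    show "h v \<notin> \<Union>(G (h v))" using mem irr v by blast
  next
    fix v L assume v: "v \<in> V" "L \<in> G (h v)"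
    then obtain L' where L: "L' \<in> F v" "L = h ` L'" using G by blast
    then show "L \<subseteq> h ` V" using sub v(1) by blast
    show "card L = 3" using L crd[OF v(1) L(1)] card_image[OF inj_on_subset[OF h sub[OF v(1) L(1)]]]
      by simp
  next
    fix v w assume "v \<in> V" "w \<in> V" "h v \<noteq> h w"
    then show "(h w \<in> \<Union>(G (h v))) \<noteq> (h v \<in> \<Union>(G (h w)))" using mem tour by metis
  qed
  show "proper g (h ` V) G \<longleftrightarrow> proper (g \<circ> h) V F"
    by (simp add: proper_def G)
qed

section \<open>Completing prescribed stars to a system\<close>

text \<open>Each step of the induction splits off one element of \<open>A\<close> together with two
  of \<open>B\<close>.\<close>

lemma ex_triple_partition:
  assumes "finite A" "finite B" "A \<inter> B = {}" "card A = t" "card B = 2 * t"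
  shows "\<exists>Q. disjoint Q \<and> \<Union>Q = A \<union> B \<and> (\<forall>T\<in>Q. card T = 3 \<and> T \<inter> A \<noteq> {})"
  using assms
proof (induction t arbitrary: A B)
  case 0
  then have "A = {}" "B = {}" by auto
  then show ?case by (intro exI[of _ "{}"]) auto
next
  case (Suc t)
  obtain a where a: "a \<in> A" using Suc.prems(4) by fastforce
  obtain U where U: "U \<subseteq> B" "card U = 2" "finite U"
    using obtain_subset_with_card_n[of 2 B] Suc.prems(5) by auto
  have "card (A - {a}) = t" "card (B - U) = 2 * t"
    using Suc.prems a U by (simp_all add: card_Diff_subset)
  moreover have "(A - {a}) \<inter> (B - U) = {}" using Suc.prems(3) by blast
  ultimately obtain Q where Q: "disjoint Q" "\<Union>Q = (A - {a}) \<union> (B - U)"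
    "\<And>T. T \<in> Q \<Longrightarrow> card T = 3 \<and> T \<inter> (A - {a}) \<noteq> {}"
    using Suc.IH[of "A - {a}" "B - U"] Suc.prems(1,2) by (metis finite_Diff)
  have "a \<notin> U" using a U Suc.prems(3) by blast
  then have "card (insert a U) = 3" using U by simp
  moreover have "disjoint (insert (insert a U) Q)"
  proof -
    have "insert a U \<inter> \<Union>Q = {}" unfolding Q(2) using a U(1) Suc.prems(3) by blast
    with disjoint_union[of "{insert a U}" Q] Q(1) show ?thesis by simp
  qed
  moreover have "\<Union>(insert (insert a U) Q) = A \<union> B" using Q(2) a U(1) by auto
  ultimately show ?case using Q(3) a by (intro exI[of _ "insert (insert a U) Q"]) blast
qed

text \<open>The size bound lets \<open>A\<close> supply one representative for each triple; the rest
  of \<open>D\<close> fills the triples up.\<close>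

lemma ex_triple_partition_meeting:
  assumes "finite D" "3 dvd card D" "A \<subseteq> D" "card D \<le> 3 * card A"
  shows "\<exists>Q. disjoint Q \<and> \<Union>Q = D \<and> (\<forall>T\<in>Q. card T = 3 \<and> T \<inter> A \<noteq> {})"
proof -
  obtain t where t: "card D = 3 * t" using assms(2) by blast
  then obtain A' where A': "A' \<subseteq> A" "card A' = t" "finite A'"
    using obtain_subset_with_card_n[of t A] assms(4) by auto
  have "A' \<subseteq> D" using A' assms(3) by blast
  then obtain Q where "disjoint Q" "\<Union>Q = A' \<union> (D - A')" "\<forall>T\<in>Q. card T = 3 \<and> T \<inter> A' \<noteq> {}"
    using ex_triple_partition[of A' "D - A'" t] A' t assms(1) by (auto simp: card_Diff_subset)
  with \<open>A' \<subseteq> D\<close> A'(1) show ?thesis by (intro exI[of _ Q]) blast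
qed

text \<open>\<open>out\<close> is the intended orientation and \<open>F0\<close> the prescribed
  triples. \<open>dvd\<close> and \<open>brk\<close> are what
  \<open>ex_triple_partition_meeting\<close> needs to group the remaining out-neighbours of
  \<open>v\<close> so that each new triple has a member coloured differently from
  \<open>v\<close>.\<close>

lemma ex_leaf_system_extending:
  fixes F0 :: "'a \<Rightarrow> 'a set set" and out :: "'a \<Rightarrow> 'a \<Rightarrow> bool"
  assumes fin: "finite W"
    and irr: "\<And>v. v \<in> W \<Longrightarrow> \<not> out v v"
    and tour: "\<And>v w. v \<in> W \<Longrightarrow> w \<in> W \<Longrightarrow> v \<noteq> w \<Longrightarrow> out v w \<noteq> out w v"
    and dis: "\<And>v. v \<in> W \<Longrightarrow> disjoint (F0 v)"
    and sub: "\<And>v L. v \<in> W \<Longrightarrow> L \<in> F0 v \<Longrightarrow> L \<subseteq> {w \<in> W. out v w}"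
    and crd: "\<And>v L. v \<in> W \<Longrightarrow> L \<in> F0 v \<Longrightarrow> card L = 3"
    and col: "\<And>v L. v \<in> W \<Longrightarrow> L \<in> F0 v \<Longrightarrow> \<exists>w\<in>L. f w \<noteq> f v"
    and dvd: "\<And>v. v \<in> W \<Longrightarrow> 3 dvd card ({w \<in> W. out v w} - \<Union>(F0 v))"
    and brk: "\<And>v. v \<in> W \<Longrightarrow> card ({w \<in> W. out v w} - \<Union>(F0 v))
                 \<le> 3 * card {w \<in> {w \<in> W. out v w} - \<Union>(F0 v). f w \<noteq> f v}"
  shows "\<exists>F. leaf_system W F \<and> proper f W F \<and> (\<forall>v\<in>W. F0 v \<subseteq> F v)"
proof -
  define D where "D v = {w \<in> W. out v w} - \<Union>(F0 v)" for v
  have "\<exists>Q. disjoint Q \<and> \<Union>Q = D v \<and> (\<forall>T\<in>Q. card T = 3 \<and> T \<inter> {w \<in> D v. f w \<noteq> f v} \<noteq> {})"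
    if "v \<in> W" for v
    using that fin dvd brk unfolding D_def by (intro ex_triple_partition_meeting) auto
  then obtain Q where Q: "\<And>v. v \<in> W \<Longrightarrow> disjoint (Q v)" "\<And>v. v \<in> W \<Longrightarrow> \<Union>(Q v) = D v"
    "\<And>v T. v \<in> W \<Longrightarrow> T \<in> Q v \<Longrightarrow> card T = 3 \<and> T \<inter> {w \<in> D v. f w \<noteq> f v} \<noteq> {}"
    by metis
  define F where "F v = F0 v \<union> Q v" for v
  have un: "\<Union>(F v) = {w \<in> W. out v w}" if "v \<in> W" for v
    using sub[OF that] Q(2)[OF that] unfolding F_def D_def by blast
  have djF: "disjoint (F v)" if "v \<in> W" for v
  proof -
    have "\<Union>(F0 v) \<inter> \<Union>(Q v) = {}" unfolding Q(2)[OF that] D_def by blast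
    then show ?thesis unfolding F_def by (rule disjoint_union[OF dis[OF that] Q(1)[OF that]])
  qed
  have subF: "L \<subseteq> W \<and> card L = 3" if "v \<in> W" "L \<in> F v" for v L
    using that un[OF that(1)] crd[of v L] Q(3)[of v L] unfolding F_def by blast
  have "leaf_system W F"
    unfolding leaf_system_def
  proof (intro conjI ballI impI)
    show "finite W" by fact
    show "v \<notin> \<Union>(F v)" if "v \<in> W" for v unfolding un[OF that] using irr[OF that] by blast
    show "(w \<in> \<Union>(F v)) \<noteq> (v \<in> \<Union>(F w))" if "v \<in> W" "w \<in> W" "v \<noteq> w" for v w
      unfolding un[OF that(1)] un[OF that(2)] using tour[OF that] that by blast
  qed (use djF subF in blast)+
  moreover have "proper f W F"
    unfolding proper_def
  proof (intro ballI)
    fix v L assume "v \<in> W" "L \<in> F v"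
    then show "\<exists>w\<in>L. f w \<noteq> f v" using col[of v L] Q(3)[of v L] unfolding F_def by blast
  qed
  moreover have "\<forall>v\<in>W. F0 v \<subseteq> F v" by (simp add: F_def)
  ultimately show ?thesis by blast
qed

section \<open>A tournament with out-degrees divisible by three\<close>

text \<open>The circulant tournament on five points together with a sink.\<close>

definition hex_beats :: "nat \<Rightarrow> nat \<Rightarrow> bool" where
  "hex_beats r s \<longleftrightarrow> r < 5 \<and> (s = 5 \<or> s = (r + 1) mod 5 \<or> s = (r + 2) mod 5)"

text \<open>The blocks \<open>{6 * g..<6 * g + 6}\<close> are ordered linearly, so the later blocks contribute a
  multiple of six to each out-degree, split evenly between both parities.\<close>

definition beats :: "nat \<Rightarrow> nat \<Rightarrow> bool" where
  "beats p q \<longleftrightarrow> p div 6 < q div 6 \<or> p div 6 = q div 6 \<and> hex_beats (p mod 6) (q mod 6)"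

lemma less_6_cases: "r < 6 \<Longrightarrow> r = 0 \<or> r = 1 \<or> r = 2 \<or> r = 3 \<or> r = 4 \<or> r = (5::nat)"
  by arith

lemma hex_beats_irrefl: "r < 6 \<Longrightarrow> \<not> hex_beats r r"
  by (drule less_6_cases) (auto simp: hex_beats_def)

lemma hex_beats_tournament: "r < 6 \<Longrightarrow> s < 6 \<Longrightarrow> r \<noteq> s \<Longrightarrow> hex_beats r s \<noteq> hex_beats s r"
  by (drule less_6_cases, drule less_6_cases) (elim disjE; simp add: hex_beats_def)

lemma beats_irrefl: "\<not> beats p p"
  by (simp add: beats_def hex_beats_irrefl)

lemma beats_tournament:
  assumes "p \<noteq> q"
  shows "beats p q \<noteq> beats q p"
proof (cases "p div 6 = q div 6")
  case True
  then have "p mod 6 \<noteq> q mod 6" using assms by (metis div_mult_mod_eq)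
  with True show ?thesis
    using hex_beats_tournament[of "p mod 6" "q mod 6"] by (simp add: beats_def)
qed (auto simp: beats_def)

section \<open>Counting by blocks of six\<close>

lemma card_less_6:
  "card {r. r < (6::nat) \<and> P r} =
     of_bool (P 0) + of_bool (P 1) + of_bool (P 2) + of_bool (P 3) + of_bool (P 4) + of_bool (P 5)"
proof -
  have "card {r. r < 6 \<and> P r} = (\<Sum>r<6. of_bool (P r))"
    by (simp add: Int_def conj_commute)
  also have "\<dots> = of_bool (P 0) + of_bool (P 1) + of_bool (P 2) + of_bool (P 3) + of_bool (P 4) + of_bool (P 5)"
    by (simp add: eval_nat_numeral)
  finally show ?thesis .
qed

text \<open>Splitting \<open>p\<close> into block and position reduces divisibility and inequalities
  to a check inside a single block.\<close>

lemma card_blocks_of_6: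
  fixes Q :: "nat \<Rightarrow> nat \<Rightarrow> bool"
  shows "card {p. p < 6 * N \<and> Q (p div 6) (p mod 6)} = (\<Sum>g<N. card {r. r < 6 \<and> Q g r})"
proof (induction N)
  case (Suc N)
  let ?A = "{p. p < 6 * N \<and> Q (p div 6) (p mod 6)}"
  let ?B = "(+) (6 * N) ` {r. r < 6 \<and> Q N r}"
  have "{p. p < 6 * Suc N \<and> Q (p div 6) (p mod 6)} = ?A \<union> ?B"
  proof (intro subset_antisym subsetI)
    fix p assume p: "p \<in> {p. p < 6 * Suc N \<and> Q (p div 6) (p mod 6)}"
    show "p \<in> ?A \<union> ?B"
    proof (cases "p < 6 * N")
      case False
      moreover have "p < 6 * Suc N" using p by blast
      ultimately have N: "p div 6 = N" by simp
      then have "p = 6 * N + p mod 6" using mult_div_mod_eq[of 6 p] by simp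
      with N show ?thesis using p by (auto intro!: image_eqI[of _ _ "p mod 6"])
    qed (use p in auto)
  qed auto
  moreover have "card (?A \<union> ?B) = card ?A + card ?B"
    by (rule card_Un_disjoint) auto
  moreover have "card ?B = card {r. r < 6 \<and> Q N r}"
    by (rule card_image) (auto simp: inj_on_def)
  ultimately show ?case using Suc by simp
qed auto

lemma three_dvd_card_blocks:
  fixes P :: "nat \<Rightarrow> bool" and Q :: "nat \<Rightarrow> nat \<Rightarrow> bool"
  assumes "\<And>p. P p \<longleftrightarrow> Q (p div 6) (p mod 6)" "\<And>g. 3 dvd card {r. r < 6 \<and> Q g r}"
  shows "3 dvd card {p. p < 6 * N \<and> P p}"
  unfolding assms(1) card_blocks_of_6 using assms(2) by (intro dvd_sum) auto

lemma card_hex_beats: "r < 6 \<Longrightarrow> card {s. s < 6 \<and> hex_beats r s} = (if r < 5 then 3 else 0)"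
  unfolding card_less_6 by (drule less_6_cases) (elim disjE; simp add: hex_beats_def)

text \<open>Parity will decide the colour of an auxiliary point. Each \<open>r < 5\<close> has three
  out-neighbours, at least one of them of opposite parity; the sink has none.\<close>

lemma card_hex_beats_le:
  "r < 6 \<Longrightarrow> card {s. s < 6 \<and> hex_beats r s} \<le> 3 * card {s. s < 6 \<and> hex_beats r s \<and> even s \<noteq> even r}"
  unfolding card_less_6 by (drule less_6_cases) (elim disjE; simp add: hex_beats_def)

lemma card_even_neq_less_6: "card {s. s < (6::nat) \<and> even s \<noteq> b} = 3"
  unfolding card_less_6 by (cases b) simp_all

text \<open>Earlier blocks contribute nothing, later ones six points each, the own block three or
  none.\<close>

lemma three_dvd_card_beats: "3 dvd card {q. q < 6 * N \<and> beats p q}"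
proof (rule three_dvd_card_blocks)
  fix g
  show "3 dvd card {r. r < 6 \<and> (p div 6 < g \<or> p div 6 = g \<and> hex_beats (p mod 6) r)}"
    using card_hex_beats[of "p mod 6"] by (cases "p div 6 < g"; cases "p div 6 = g") simp_all
qed (simp add: beats_def)

lemma card_beats_le:
  "card {q. q < 6 * N \<and> beats p q} \<le> 3 * card {q. q < 6 * N \<and> beats p q \<and> even q \<noteq> even p}"
proof -
  define Q where "Q g r \<longleftrightarrow> p div 6 < g \<or> p div 6 = g \<and> hex_beats (p mod 6) r" for g r
  have par: "even (q mod 6) \<longleftrightarrow> even q" for q :: nat by presburger
  have Q: "beats p q \<longleftrightarrow> Q (q div 6) (q mod 6)" for q by (simp add: beats_def Q_def)
  have "card {r. r < 6 \<and> Q g r} \<le> 3 * card {r. r < 6 \<and> Q g r \<and> even r \<noteq> even p}" for g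
    using card_hex_beats_le[of "p mod 6"] card_even_neq_less_6[of "even p"]
    unfolding Q_def par by (cases "p div 6 < g"; cases "p div 6 = g") simp_all
  then have "card {q. q < 6 * N \<and> Q (q div 6) (q mod 6)}
      \<le> 3 * card {q. q < 6 * N \<and> Q (q div 6) (q mod 6) \<and> even (q mod 6) \<noteq> even p}"
    unfolding card_blocks_of_6[of N Q] card_blocks_of_6[of N "\<lambda>g r. Q g r \<and> even r \<noteq> even p"]
      sum_distrib_left
    by (rule sum_mono)
  then show ?thesis unfolding Q par .
qed

text \<open>Pigeonhole: fibres of size at most two would give
  \<open>m \<le> 2 * card T\<close>.\<close>

lemma ex_three_equal_fibre:
  assumes "finite T" "\<And>a. a < m \<Longrightarrow> \<phi> a \<in> T" "2 * card T < m"
  shows "\<exists>t. t \<subseteq> {..<m} \<and> card t = 3 \<and> (\<forall>a\<in>t. \<forall>b\<in>t. \<phi> a = \<phi> b)"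
proof -
  have "\<exists>y\<in>T. 3 \<le> card {a \<in> {..<m}. \<phi> a = y}"
  proof (rule ccontr)
    assume "\<not> ?thesis"
    then have "card {a \<in> {..<m}. \<phi> a = y} \<le> 2" if "y \<in> T" for y using that by force
    then have "(\<Sum>y\<in>T. card {a \<in> {..<m}. \<phi> a = y}) \<le> (\<Sum>y\<in>T. 2)" by (rule sum_mono)
    moreover have "{..<m} = (\<Union>y\<in>T. {a \<in> {..<m}. \<phi> a = y})" using assms(2) by auto
    then have "card {..<m} \<le> (\<Sum>y\<in>T. card {a \<in> {..<m}. \<phi> a = y})"
      using card_UN_le[OF assms(1), of "\<lambda>y. {a \<in> {..<m}. \<phi> a = y}"] by argo
    ultimately show False using assms(3) by simp
  qed
  then obtain y where "3 \<le> card {a \<in> {..<m}. \<phi> a = y}" by blast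
  then obtain t where "t \<subseteq> {a \<in> {..<m}. \<phi> a = y}" "card t = 3"
    by (meson obtain_subset_with_card_n)
  then show ?thesis by (intro exI[of _ t]) auto
qed

section \<open>Adding a colour\<close>

text \<open>\<open>Copy a v\<close> is the vertex \<open>v\<close> in copy number \<open>a\<close>; the points \<open>Aux p\<close> with \<open>p\<close> even get the new
  colour, those with \<open>p\<close> odd an old one.\<close>

datatype 'a point = Copy nat 'a | Aux nat

text \<open>By \<open>low\<close>, \<open>f\<close> uses the least possible number of colours; this
  forces every copy of \<open>V\<close> to show all colours when only that many are
  available.\<close>

lemma ex_leaf_system_one_more_colour:
  fixes V :: "'a set"
  assumes sys: "leaf_system V F" and f: "proper f V F" and ne: "V \<noteq> {}"
    and low: "\<And>g. proper g V F \<Longrightarrow> card (f ` V) \<le> card (g ` V)"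
  shows "\<exists>(W :: 'a point set) G f'. leaf_system W G \<and> proper f' W G \<and>
    card (f' ` W) = Suc (card (f ` V)) \<and> (\<forall>g. proper g W G \<longrightarrow> card (g ` W) \<noteq> card (f ` V))"
proof -
  have fin: "finite V" and dis: "\<And>v. v \<in> V \<Longrightarrow> disjoint (F v)"
    and sub: "\<And>v L. v \<in> V \<Longrightarrow> L \<in> F v \<Longrightarrow> L \<subseteq> V"
    and crd: "\<And>v L. v \<in> V \<Longrightarrow> L \<in> F v \<Longrightarrow> card L = 3"
    and irr: "\<And>v. v \<in> V \<Longrightarrow> v \<notin> \<Union>(F v)"
    and tour: "\<And>v w. v \<in> V \<Longrightarrow> w \<in> V \<Longrightarrow> v \<noteq> w \<Longrightarrow> (w \<in> \<Union>(F v)) \<noteq> (v \<in> \<Union>(F w))"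
    using sys unfolding leaf_system_def by blast+

  \<comment> \<open>Parameters, vertices and orientation of the enlarged system\<close>
  define n K where "n = card V" and "K = card (f ` V)"
  \<comment> \<open>A copy has \<open>K ^ n\<close> possible colour patterns. \<open>m\<close>
    exceeds twice this number, for the pigeonhole argument, and is a multiple of six, so that
    \<open>beats\<close> gives out-degrees divisible by three among the copy numbers.\<close>
  define M where "M = K ^ n + 1"
  define m where "m = 6 * M"
  have "finite {t. t \<subseteq> {..<m} \<and> card t = 3}" by simp
  then obtain ts where ts: "set ts = {t. t \<subseteq> {..<m} \<and> card t = 3}"
    using finite_list by blast
  \<comment> \<open>Block \<open>g\<close> of auxiliary points serves the triple
    \<open>\<tau> g\<close>; the default \<open>{}\<close> means that it serves none.\<close>
  define \<tau> where "\<tau> g = (if g < length ts then ts ! g else {})" for g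
  have \<tau>: "\<tau> g \<subseteq> {..<m} \<and> card (\<tau> g) = 3" if "\<tau> g \<noteq> {}" for g
    using that ts nth_mem[of g ts] by (auto simp: \<tau>_def split: if_splits)
  \<comment> \<open>The blocks beyond \<open>length ts\<close> beat no copy at all; there are enough of them to give every
    vertex of a copy sufficiently many out-neighbours of the new colour.\<close>
  define N where "N = 3 * length ts + m * n"
  \<comment> \<open>A positive \<open>N\<close> provides the point \<open>Aux 0\<close>, so the new
    colour really occurs.\<close>
  have "0 < n" using ne fin by (simp add: n_def card_gt_0_iff)
  then have N_pos: "0 < N" by (simp add: N_def m_def M_def)
  define W :: "'a point set" where "W = case_prod Copy ` ({..<m} \<times> V) \<union> Aux ` {..<6 * N}"
  have W: "Copy a i \<in> W \<longleftrightarrow> a < m \<and> i \<in> V" "Aux p \<in> W \<longleftrightarrow> p < 6 * N" for a i p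
    by (auto simp: W_def)
  obtain c where c: "c \<notin> f ` V"
    using fin by (meson ex_new_if_finite finite_imageI infinite_UNIV_nat)
  obtain c0 where c0: "c0 \<in> f ` V" using ne by blast
  define f' where "f' x = (case x of Copy a i \<Rightarrow> f i | Aux p \<Rightarrow> if even p then c else c0)" for x :: "'a point"
  \<comment> \<open>All three even points of a block serve the same triple, so a copy beats either
    six or three points of each block, always a multiple of three.\<close>
  define hit where "hit p a \<longleftrightarrow> even p \<and> a \<in> \<tau> (p div 6)" for p a
  define out :: "'a point \<Rightarrow> 'a point \<Rightarrow> bool" where
    "out x y = (case x of
        Copy a i \<Rightarrow> (case y of Copy b j \<Rightarrow> if a = b then j \<in> \<Union>(F i) else beats a b | Aux p \<Rightarrow> \<not> hit p a)
      | Aux p \<Rightarrow> (case y of Copy a i \<Rightarrow> hit p a | Aux q \<Rightarrow> beats p q))" for x y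
  \<comment> \<open>The test on \<open>\<tau>\<close> keeps out the empty leaf set that a block
    without a triple would otherwise produce.\<close>
  define F0 :: "'a point \<Rightarrow> 'a point set set" where
    "F0 x = (case x of
        Copy a i \<Rightarrow> (`) (Copy a) ` F i
      | Aux p \<Rightarrow> if even p \<and> \<tau> (p div 6) \<noteq> {} then (\<lambda>i. (\<lambda>a. Copy a i) ` \<tau> (p div 6)) ` V else {})" for x

  have mem: "Copy b j \<in> case_prod Copy ` (S \<times> T) \<longleftrightarrow> b \<in> S \<and> j \<in> T" "Aux q \<notin> case_prod Copy ` Z"
    "Copy b j \<notin> Aux ` U" "Aux q \<in> Aux ` U \<longleftrightarrow> q \<in> U" for b q S U Z and j :: 'a and T
    by force+
  have mem_F0: "Copy b j \<in> \<Union>(F0 (Copy a i)) \<longleftrightarrow> a = b \<and> j \<in> \<Union>(F i)"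
    "Aux q \<notin> \<Union>(F0 (Copy a i))"
    "Copy b j \<in> \<Union>(F0 (Aux p)) \<longleftrightarrow> hit p b \<and> j \<in> V"
    "Aux q \<notin> \<Union>(F0 (Aux p))" for a b i j p q
    by (auto simp: F0_def hit_def)
  \<comment> \<open>The prescribed stars use up precisely the out-neighbours within the own copy, so
    the remainder is the same for all \<open>i\<close>.\<close>
  have rem_Copy: "{w \<in> W. out (Copy a i) w} - \<Union>(F0 (Copy a i))
      = case_prod Copy ` ({b. b < m \<and> beats a b} \<times> V) \<union> Aux ` {p. p < 6 * N \<and> \<not> hit p a}"
    (is "?L = ?R") for a i
  proof (rule set_eqI)
    show "x \<in> ?L \<longleftrightarrow> x \<in> ?R" for x
      using beats_irrefl
      by (cases x) (auto simp only: Diff_iff Un_iff mem_Collect_eq mem mem_F0 W out_def point.case split: if_splits)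
  qed
  \<comment> \<open>All edges from an auxiliary point into copies lie in prescribed stars.\<close>
  have rem_Aux: "{w \<in> W. out (Aux p) w} - \<Union>(F0 (Aux p)) = Aux ` {q. q < 6 * N \<and> beats p q}"
    (is "?L = ?R") for p
  proof (rule set_eqI)
    show "x \<in> ?L \<longleftrightarrow> x \<in> ?R" for x
      by (cases x) (auto simp only: Diff_iff mem_Collect_eq mem mem_F0 W out_def point.case)
  qed
  have injAux: "inj_on Aux S" for S by (simp add: inj_on_def)
  have card_rem_Copy: "card (case_prod Copy ` ({b. b < m \<and> beats a b} \<times> V) \<union> Aux ` {p. p < 6 * N \<and> \<not> hit p a})
      = card {b. b < m \<and> beats a b} * n + card {p. p < 6 * N \<and> \<not> hit p a}" for a
  proof -
    have "card (case_prod Copy ` ({b. b < m \<and> beats a b} \<times> V)) = card {b. b < m \<and> beats a b} * n"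
      by (subst card_image) (auto simp: inj_on_def card_cartesian_product n_def)
    moreover have "card (case_prod Copy ` ({b. b < m \<and> beats a b} \<times> V) \<union> Aux ` {p. p < 6 * N \<and> \<not> hit p a})
        = card (case_prod Copy ` ({b. b < m \<and> beats a b} \<times> V)) + card (Aux ` {p. p < 6 * N \<and> \<not> hit p a} :: 'a point set)"
      using fin by (intro card_Un_disjoint) auto
    ultimately show ?thesis by (simp add: card_image[OF injAux])
  qed
  have par: "even q \<longleftrightarrow> even (q mod 6)" for q :: nat by presburger

  \<comment> \<open>Conditions for completing the prescribed stars\<close>
  have dvdW: "3 dvd card ({w \<in> W. out x w} - \<Union>(F0 x))" if "x \<in> W" for x
  proof (cases x)
    case (Copy a i)
    then have ai: "a < m" "i \<in> V" using that W by auto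
    have "3 dvd card {p. p < 6 * N \<and> \<not> hit p a}"
    proof (rule three_dvd_card_blocks)
      show "3 dvd card {r. r < (6::nat) \<and> \<not> (even r \<and> a \<in> \<tau> g)}" for g
        unfolding card_less_6 by (cases "a \<in> \<tau> g"; simp; presburger)
    qed (simp add: hit_def par[symmetric])
    moreover have "3 dvd card {b. b < m \<and> beats a b}"
      unfolding m_def by (rule three_dvd_card_beats)
    ultimately show ?thesis
      unfolding Copy rem_Copy card_rem_Copy by (intro dvd_add dvd_mult2)
  next
    case (Aux p)
    show ?thesis
      unfolding Aux rem_Aux card_image[OF injAux] by (rule three_dvd_card_beats)
  qed
  have brkW: "card ({w \<in> W. out x w} - \<Union>(F0 x))
      \<le> 3 * card {w \<in> {w \<in> W. out x w} - \<Union>(F0 x). f' w \<noteq> f' x}" if "x \<in> W" for x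
  proof (cases x)
    case (Copy a i)
    then have ai: "a < m" "i \<in> V" using that W by auto
    let ?R = "case_prod Copy ` ({b. b < m \<and> beats a b} \<times> V) \<union> Aux ` {p. p < 6 * N \<and> \<not> hit p a}"
    \<comment> \<open>From block \<open>length ts\<close> on, no point hits copy \<open>a\<close>,
      so each of these blocks supplies three out-neighbours of the new colour.\<close>
    have "3 * (N - length ts) = (\<Sum>g\<in>{length ts..<N}. 3)" by simp
    also have "\<dots> \<le> (\<Sum>g\<in>{length ts..<N}. card {r. r < (6::nat) \<and> even r \<and> a \<notin> \<tau> g})"
      unfolding card_less_6 by (intro sum_mono) (simp add: \<tau>_def)
    also have "\<dots> \<le> (\<Sum>g<N. card {r. r < (6::nat) \<and> even r \<and> a \<notin> \<tau> g})"
      by (intro sum_mono2) auto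
    also have "\<dots> = card {p. p < 6 * N \<and> even (p mod 6) \<and> a \<notin> \<tau> (p div 6)}"
      by (rule card_blocks_of_6[symmetric])
    also have "\<dots> = card (Aux ` {p. p < 6 * N \<and> even (p mod 6) \<and> a \<notin> \<tau> (p div 6)} :: 'a point set)"
      by (simp add: card_image[OF injAux])
    also have "\<dots> \<le> card {w \<in> ?R. f' w \<noteq> f' x}"
    proof (rule card_mono)
      show "Aux ` {p. p < 6 * N \<and> even (p mod 6) \<and> a \<notin> \<tau> (p div 6)} \<subseteq> {w \<in> ?R. f' w \<noteq> f' x}"
        using ai c by (auto simp: hit_def Copy f'_def par[symmetric])
    qed (use fin in simp)
    finally have "3 * (N - length ts) \<le> card {w \<in> ?R. f' w \<noteq> f' x}" .
    moreover have "card {b. b < m \<and> beats a b} \<le> card {..<m}" by (rule card_mono) auto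
    then have "card {b. b < m \<and> beats a b} * n \<le> m * n" by simp
    moreover have "card {p. p < 6 * N \<and> \<not> hit p a} \<le> 6 * N"
      using card_mono[of "{..<6 * N}" "{p. p < 6 * N \<and> \<not> hit p a}"] by auto
    moreover have "N = 3 * length ts + m * n" by (rule N_def)
    \<comment> \<open>The remainder has at most \<open>m * n + 6 * N\<close> elements, and the
      choice of \<open>N\<close> makes this at most \<open>9 * (N - length ts)\<close>.\<close>
    ultimately have "card ?R \<le> 3 * card {w \<in> ?R. f' w \<noteq> f' x}"
      unfolding card_rem_Copy by linarith
    then show ?thesis unfolding Copy rem_Copy .
  next
    case (Aux p)
    then have p: "p < 6 * N" using that W by simp
    \<comment> \<open>Since \<open>c0\<close> differs from \<open>c\<close>, auxiliary points differ
      in colour exactly when they differ in parity.\<close>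
    have eq: "Aux ` {q. q < 6 * N \<and> beats p q \<and> even q \<noteq> even p}
        = {w \<in> Aux ` {q. q < 6 * N \<and> beats p q}. f' w \<noteq> f' (Aux p)}"
      using c c0 by (auto simp: f'_def split: if_splits)
    have "card {w \<in> Aux ` {q. q < 6 * N \<and> beats p q}. f' w \<noteq> f' (Aux p)}
        = card {q. q < 6 * N \<and> beats p q \<and> even q \<noteq> even p}"
      unfolding eq[symmetric] by (rule card_image[OF injAux])
    then show ?thesis
      unfolding Aux rem_Aux card_image[OF injAux] by (simp only: card_beats_le)
  qed
  have finW0: "finite W" using fin by (simp add: W_def)
  have irrW: "\<not> out x x" if "x \<in> W" for x
    using that irr beats_irrefl W by (cases x) (auto simp: out_def)
  have tourW: "out x y \<noteq> out y x" if "x \<in> W" "y \<in> W" "x \<noteq> y" for x y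
  proof (cases x)
    case x: (Copy a i)
    show ?thesis
    proof (cases y)
      case y: (Copy b j)
      show ?thesis
      proof (cases "a = b")
        case True
        then show ?thesis using tour[of i j] that x y by (simp add: out_def W)
      next
        case False
        then show ?thesis using beats_tournament[of a b] x y by (simp add: out_def)
      qed
    qed (simp add: out_def x)
  next
    case x: (Aux p)
    show ?thesis
    proof (cases y)
      case y: (Aux q)
      then show ?thesis using beats_tournament[of p q] x that(3) by (simp add: out_def)
    qed (simp add: out_def x)
  qed
  have disW: "disjoint (F0 x)" if "x \<in> W" for x
  proof (cases x)
    case (Copy a i)
    then have "i \<in> V" using that W by simp
    then show ?thesis unfolding Copy F0_def point.case
      by (intro disjoint_image dis) (auto simp: inj_on_def)
  next
    case (Aux p)
    show ?thesis unfolding Aux by (auto simp: F0_def disjoint_def)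
  qed
  have subW: "L \<subseteq> {w \<in> W. out x w}" if "x \<in> W" "L \<in> F0 x" for x L
  proof (cases x)
    case (Copy a i)
    then show ?thesis using that sub[of i] W by (auto simp: F0_def out_def)
  next
    case (Aux p)
    then show ?thesis using that \<tau>[of "p div 6"] W
      by (auto simp: F0_def out_def hit_def split: if_splits)
  qed
  have crdW: "card L = 3" if "x \<in> W" "L \<in> F0 x" for x L
  proof (cases x)
    case (Copy a i)
    then show ?thesis using that crd[of i] W by (auto simp: F0_def card_image inj_on_def)
  next
    case (Aux p)
    then show ?thesis using that \<tau>[of "p div 6"] W
      by (auto simp: F0_def card_image inj_on_def split: if_splits)
  qed
  have colW: "\<exists>w\<in>L. f' w \<noteq> f' x" if xL: "x \<in> W" "L \<in> F0 x" for x L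
  proof (cases x)
    case (Copy a i)
    then obtain L' where L': "L' \<in> F i" "L = Copy a ` L'" and i: "i \<in> V"
      using xL W by (auto simp: F0_def)
    then obtain j where "j \<in> L'" "f j \<noteq> f i" using f unfolding proper_def by blast
    then show ?thesis using L'(2) Copy by (auto simp: f'_def)
  next
    case (Aux p)
    then obtain i where p: "even p" "\<tau> (p div 6) \<noteq> {}"
      and i: "i \<in> V" "L = (\<lambda>a. Copy a i) ` \<tau> (p div 6)"
      using xL by (auto simp: F0_def split: if_splits)
    then show ?thesis using c Aux by (auto simp: f'_def)
  qed

  \<comment> \<open>The completed system: one more colour suffices, the old number does not\<close>
  have "\<exists>G. leaf_system W G \<and> proper f' W G \<and> (\<forall>x\<in>W. F0 x \<subseteq> G x)"
    by (rule ex_leaf_system_extending[where out = out and ?F0.0 = F0])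
      (fact finW0 irrW tourW disW subW crdW colW dvdW brkW)+
  then obtain G where G: "leaf_system W G" "proper f' W G" "\<And>x. x \<in> W \<Longrightarrow> F0 x \<subseteq> G x"
    by blast
  have "f' ` W = insert c (f ` V)"
  proof (intro subset_antisym subsetI)
    fix y assume "y \<in> f' ` W"
    then show "y \<in> insert c (f ` V)" using c0 by (auto simp: W_def f'_def)
  next
    fix y assume "y \<in> insert c (f ` V)"
    then consider "y = c" | i where "i \<in> V" "y = f i" by blast
    then show "y \<in> f' ` W"
    proof cases
      case 1
      then have "y = f' (Aux 0)" by (simp add: f'_def)
      moreover have "Aux 0 \<in> W" using W(2)[of 0] N_pos by simp
      ultimately show ?thesis by (rule image_eqI)
    next
      case 2
      then have "y = f' (Copy 0 i)" by (simp add: f'_def)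
      moreover have "Copy 0 i \<in> W" using W(1)[of 0 i] 2 by (simp add: m_def M_def)
      ultimately show ?thesis by (rule image_eqI)
    qed
  qed
  then have "card (f' ` W) = Suc (card (f ` V))" using c fin by simp
  moreover have "card (g ` W) \<noteq> card (f ` V)" if g: "proper g W G" for g
  proof
    assume "card (g ` W) = card (f ` V)"
    then have gK: "card (g ` W) = K" by (simp add: K_def)
    have finW: "finite (g ` W)" using fin by (simp add: W_def)
    \<comment> \<open>\<open>G\<close> contains the stars of each copy, so \<open>g\<close> properly
      colours the copy and by \<open>low\<close> needs all \<open>K\<close> available colours
      there.\<close>
    have full: "(\<lambda>i. g (Copy a i)) ` V = g ` W" if a: "a < m" for a
    proof (rule card_seteq[OF finW])
      show "(\<lambda>i. g (Copy a i)) ` V \<subseteq> g ` W" using a W by auto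
      have "proper (\<lambda>i. g (Copy a i)) V F"
        unfolding proper_def
      proof (intro ballI)
        fix i L assume i: "i \<in> V" "L \<in> F i"
        then have aiW: "Copy a i \<in> W" using W(1)[of a i] a by simp
        have "Copy a ` L \<in> F0 (Copy a i)" using i(2) by (simp add: F0_def)
        then have "Copy a ` L \<in> G (Copy a i)" using G(3)[OF aiW] by blast
        then have "\<exists>w\<in>Copy a ` L. g w \<noteq> g (Copy a i)" using g aiW unfolding proper_def by blast
        then show "\<exists>j\<in>L. g (Copy a j) \<noteq> g (Copy a i)" by blast
      qed
      then show "card (g ` W) \<le> card ((\<lambda>i. g (Copy a i)) ` V)" using low gK by (simp add: K_def)
    qed
    have lt: "2 * card (V \<rightarrow>\<^sub>E g ` W) < m"
      using fin gK by (simp add: card_funcsetE m_def M_def n_def)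
    have finE: "finite (V \<rightarrow>\<^sub>E g ` W)" using fin finW by (intro finite_PiE)
    \<comment> \<open>Restricting to \<open>V\<close> makes the colour patterns members of a finite
      function space, where equality means equality on \<open>V\<close>.\<close>
    have inE: "restrict (\<lambda>i. g (Copy a i)) V \<in> V \<rightarrow>\<^sub>E g ` W" if "a < m" for a
      using that W by auto
    obtain t where t: "t \<subseteq> {..<m}" "card t = 3"
      and eq: "\<And>a b. a \<in> t \<Longrightarrow> b \<in> t
        \<Longrightarrow> restrict (\<lambda>i. g (Copy a i)) V = restrict (\<lambda>i. g (Copy b i)) V"
      using ex_three_equal_fibre[of _ _ "\<lambda>a. restrict (\<lambda>i. g (Copy a i)) V", OF finE inE lt] by blast
    obtain l where l: "l < length ts" "ts ! l = t" using t ts by (metis (mono_tags, lifting) in_set_conv_nth mem_Collect_eq)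
    \<comment> \<open>The first point of block \<open>l\<close>, which is even and therefore a
      centre for the triple \<open>t\<close>.\<close>
    define p where "p = 6 * l"
    have p: "\<tau> (p div 6) = t" "even p" using l by (simp_all add: p_def \<tau>_def)
    have pW: "Aux p \<in> W" using W l(1) by (simp add: p_def N_def)
    obtain a where a: "a \<in> t" using t(2) by fastforce
    \<comment> \<open>The colour of the centre occurs in copy \<open>a\<close> at some
      \<open>i\<close>, hence at the same \<open>i\<close> in all three copies: the star with these
      leaves is monochromatic.\<close>
    then have "g (Aux p) \<in> (\<lambda>i. g (Copy a i)) ` V" using full[of a] t(1) pW by auto
    then obtain i where i: "i \<in> V" "g (Copy a i) = g (Aux p)" by fastforce
    have same: "g (Copy b i) = g (Aux p)" if "b \<in> t" for b
      using fun_cong[OF eq[OF that a], of i] i by simp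
    have "(\<lambda>b. Copy b i) ` t \<in> F0 (Aux p)" using p a i(1) by (auto simp: F0_def)
    then have "(\<lambda>b. Copy b i) ` t \<in> G (Aux p)" using G(3)[OF pW] by blast
    then have "\<exists>w\<in>(\<lambda>b. Copy b i) ` t. g w \<noteq> g (Aux p)"
      using bspec[OF bspec[OF g[unfolded proper_def] pW]] by blast
    then show False using same by auto
  qed
  ultimately show ?thesis using G(1,2) by blast
qed

section \<open>Return to chromatic star systems on the naturals\<close>

theorem theorem2p3:
  fixes k :: nat
  assumes "k \<ge> 3"
    and "\<exists>n (V :: 'a set) B. star_system 3 n V B \<and> chromatic (k - 1) V B"
  shows "\<exists>n (V :: nat set) B. star_system 3 n V B \<and> chromatic k V B"
proof -
  obtain n B and V :: "'a set" where B: "star_system 3 n V B" "chromatic (k - 1) V B"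
    using assms(2) by blast
  obtain F where F: "leaf_system V F" "B = stars V F"
    using star_system_imp_leaf_system[OF B(1)] .
  have fin: "finite V" using F(1) by (simp add: leaf_system_def)
  obtain f where f: "proper f V F" "card (f ` V) = k - 1"
    and no: "\<And>g. proper g V F \<Longrightarrow> card (g ` V) \<noteq> k - 1 - 1"
    using B(2) unfolding chromatic_def F(2) colourable_stars_iff[OF F(1)] by blast
  have "V \<noteq> {}" using f(2) assms(1) by auto
  \<comment> \<open>A proper colouring with fewer colours could be refined to exactly
    \<open>k - 2\<close> of them, which \<open>no\<close> forbids.\<close>
  have low: "card (f ` V) \<le> card (g ` V)" if "proper g V F" for g
  proof (rule ccontr)
    assume "\<not> ?thesis"
    then have "card (g ` V) \<le> k - 1 - 1" using f(2) by linarith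
    moreover have "k - 1 - 1 \<le> card V" using f(2) card_image_le[OF fin, of f] by linarith
    ultimately show False using proper_refine[OF F(1) that] no by blast
  qed
  obtain W :: "'a point set" and G f' where W: "leaf_system W G" "proper f' W G"
    "card (f' ` W) = Suc (card (f ` V))" "\<And>g. proper g W G \<Longrightarrow> card (g ` W) \<noteq> card (f ` V)"
    using ex_leaf_system_one_more_colour[OF F(1) f(1) \<open>V \<noteq> {}\<close> low] by blast
  have finW: "finite W" using W(1) by (simp add: leaf_system_def)
  obtain h :: "'a point \<Rightarrow> nat" where h: "inj_on h W"
    using finite_imp_inj_to_nat_seg[OF finW] by blast
  let ?G = "\<lambda>v. (`) h ` G (inv_into W h v)"
  note G = leaf_system_image[OF W(1) h]
  have "colourable k (h ` W) (stars (h ` W) ?G)"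
    unfolding colourable_stars_iff[OF G(1)] G(2)
  proof (intro exI conjI)
    \<comment> \<open>The transported colouring agrees with \<open>f'\<close> on \<open>W\<close>,
      and properness depends only on \<open>W\<close> because all leaves lie there.\<close>
    have "(f' \<circ> inv_into W h \<circ> h) x = f' x" if "x \<in> W" for x
      using that h by simp
    then show "proper (f' \<circ> inv_into W h \<circ> h) W G"
      using W(1,2) unfolding proper_def leaf_system_def by (metis subsetD)
    have "(f' \<circ> inv_into W h) ` h ` W = f' ` W" using h by (auto simp: image_iff)
    then show "card ((f' \<circ> inv_into W h) ` h ` W) = k" using W(3) f(2) assms(1) by simp
  qed
  moreover have "\<not> colourable (k - 1) (h ` W) (stars (h ` W) ?G)"
    unfolding colourable_stars_iff[OF G(1)] G(2) using W(4) f(2) by (metis image_comp)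
  ultimately show ?thesis
    using star_system_stars[OF G(1)] unfolding chromatic_def by blast
qed

end
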